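(* Each non-discrete Polish Abelian group $G$ contains two closed subsets $A,B\subset G$ such that $\mathrm{ind}_P(A)=\mathrm{ind}_P(B)=\mathfrak{c}$ and $\mathrm{Ind}_P(A\cup B)=1$.
   Context: $\mathfrak{c}$ is the cardinality of the continuum. For a non-empty subset $A$ of a group $G$, the packing index and the almost packing index of $A$ are the cardinals $$\mathrm{ind}_P(A)=\sup\{|S| : S\subset G \text{ and } \{xA\}_{x\in S}\text{ is disjoint}\},$$ $$\mathrm{Ind}_P(A)=\sup\{|S| : S\subset G \text{ and } \{xA\}_{x\in S}\text{ is almost disjoint}\},$$ where $\{xA\}_{x\in S}$ is called disjoint if $xA\cap yA=\emptyset$ for all distinct $x,y\in S$, and almost disjoint if $|xA\cap yA|<|A|$ for all distinct $x,y\in S$. *)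

theory Defs
  imports "HOL-Analysis.Analysis"
begin

unbundle cardinal_syntax

no_notation elt_set_eq (infix "=o" 50)

(* Cardinals are represented by cardinal orders (Card_order), compared by \<le>o, <o and =o.
   Groups are written additively, so the translate xA is (+) x ` A. *)

definition is_card_sup :: "'a rel set \<Rightarrow> 'a rel \<Rightarrow> bool" where
  "is_card_sup K r \<longleftrightarrow> Card_order r \<and> (\<forall>k\<in>K. k \<le>o r) \<and>
     (\<forall>s :: 'a rel. Card_order s \<and> (\<forall>k\<in>K. k \<le>o s) \<longrightarrow> r \<le>o s)"

(* Determined only up to =o. *)
definition card_sup :: "'a rel set \<Rightarrow> 'a rel" where
  "card_sup K = (SOME r. is_card_sup K r)"

(* A set of cardinalities of subsets of 'a has its supremum among the cardinals on 'a;
   it is least also among upper bounds living on other types (card_sup_least below). *)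
lemma is_card_sup_card_sup:
  fixes K :: "'a rel set"
  assumes "K \<subseteq> range card_of"
  shows "is_card_sup K (card_sup K)"
proof -
  define R where "R = {s :: 'a rel. Card_order s \<and> (\<forall>k\<in>K. k \<le>o s)}"
  have "|UNIV :: 'a set| \<in> R"
    using assms by (auto simp: R_def card_of_Card_order intro: card_of_mono1)
  moreover have "\<forall>r\<in>R. Card_order r" by (simp add: R_def)
  ultimately obtain r where "r \<in> R" "\<forall>s\<in>R. r \<le>o s"
    using exists_minim_Card_order[of R] by blast
  then have "is_card_sup K r" by (auto simp: R_def is_card_sup_def)
  then show ?thesis unfolding card_sup_def by (rule someI)
qed

lemma card_sup_upper:
  fixes S :: "'a set"
  assumes "K \<subseteq> range card_of" "|S| \<in> K"
  shows "|S| \<le>o card_sup K"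
  using is_card_sup_card_sup[OF assms(1)] assms(2) by (auto simp: is_card_sup_def)

lemma card_sup_least:
  fixes K :: "'a rel set" and s :: "'b rel"
  assumes K: "K \<subseteq> range card_of" and s: "Card_order s" and ub: "\<And>k. k \<in> K \<Longrightarrow> k \<le>o s"
  shows "card_sup K \<le>o s"
proof -
  have sup: "is_card_sup K (card_sup K)" by (rule is_card_sup_card_sup[OF K])
  show ?thesis
  proof (rule ccontr)
    assume "\<not> ?thesis"
    moreover have "Well_order (card_sup K)" "Well_order s"
      using sup s by (auto simp: is_card_sup_def card_order_on_def)
    ultimately have less: "s <o card_sup K" by (simp add: not_ordLeq_iff_ordLess)
    then have "s \<le>o card_sup K" by (rule ordLess_imp_ordLeq)
    then have "|Field s| \<le>o card_sup K"
      using card_of_Field_ordIso[OF s] ordIso_ordLeq_trans by blast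
    then obtain B where B: "B \<subseteq> Field (card_sup K)" "|Field s| =o |B|"
      using internalize_card_of_ordLeq[of "Field s" "card_sup K"] by blast
    have sB: "s =o |B|"
      using B(2) card_of_Field_ordIso[OF s] ordIso_symmetric ordIso_transitive by blast
    then have "\<forall>k\<in>K. k \<le>o |B|" using ub ordLeq_ordIso_trans by blast
    then have "card_sup K \<le>o |B|"
      using sup card_of_Card_order[of B] by (auto simp: is_card_sup_def)
    then have "card_sup K \<le>o s" using sB ordIso_symmetric ordLeq_ordIso_trans by blast
    with less show False using not_ordLess_ordLeq by blast
  qed
qed

definition almost_disjoint_translates :: "'a::group_add set \<Rightarrow> 'a set \<Rightarrow> bool" where
  "almost_disjoint_translates A S \<longleftrightarrow>
     (\<forall>x\<in>S. \<forall>y\<in>S. x \<noteq> y \<longrightarrow> |(+) x ` A \<inter> (+) y ` A| <o |A| )"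

(* Both indices are meant for non-empty A only: the empty set has packing index |G| but
   almost packing index 1. *)
definition packing_index :: "'a::group_add set \<Rightarrow> 'a rel" where
  "packing_index A = card_sup { |S| | S. disjoint_family_on (\<lambda>x. (+) x ` A) S}"

definition almost_packing_index :: "'a::group_add set \<Rightarrow> 'a rel" where
  "almost_packing_index A = card_sup { |S| | S. almost_disjoint_translates A S}"

end

theory Submission
  imports Defs
begin

text \<open>
  Every \<open>g\<close> in a Polish abelian group can be expanded into digits: subtract from \<open>g\<close> the nearest
  point of a net, expand the small remainder with the help of a finer net, and so on. Let \<open>A\<close>
  consist of the sums of digits at even places and \<open>B\<close> of the negated sums of digits at odd places.
  Both series converge, because a Polish abelian group is complete as a topological group
  (\<open>polish_ab_group_complete\<close>). Then every \<open>g\<close> has the form \<open>a - b\<close>, so \<open>A\<close> meets \<open>g + B\<close>. If each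
  net offers two choices at each step (\<open>exists_redundant_digits\<close>), they meet in continuum many
  points (\<open>exists_packing_pair\<close>). The group itself has no more points than that, so any two
  translates of \<open>A \<union> B\<close> intersect in a set of full cardinality, and an almost disjoint family
  of translates has at most one member.

  If the nets are refined fast enough, the size of a difference of two elements of \<open>A\<close> is determined,
  roughly, by the first place at which their digits differ, and this place is even
  (\<open>expansion_differences\<close>). So \<open>A\<close> is closed (\<open>closed_expansions\<close>), and no difference of elements
  of \<open>A\<close> has a size that belongs to the odd places. Sums of subsequences of a fixed sequence of
  elements of such sizes differ by such sizes again, and thus are continuum many points whose
  translates of \<open>A\<close> are disjoint (\<open>continuum_packing_expansions\<close>). The same holds for \<open>B\<close> with the
  parities exchanged.

  Sizes are measured by a chain \<open>W\<close> of symmetric neighbourhoods of zero (locale \<open>scale\<close>), in which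
  an element of \<open>W k\<close> counts as smaller the larger \<open>k\<close> is.
\<close>


section \<open>Completeness of Polish abelian groups\<close>

lemma symmetric_nbhd_half:
  fixes U :: "'a::topological_ab_group_add set"
  assumes "open U" "0 \<in> U"
  obtains V where "open V" "0 \<in> V" "\<And>x. x \<in> V \<Longrightarrow> - x \<in> V"
    "\<And>x y. x \<in> V \<Longrightarrow> y \<in> V \<Longrightarrow> x + y \<in> U"
proof -
  have "eventually (\<lambda>z. fst z + snd z \<in> U) (nhds (0::'a) \<times>\<^sub>F nhds (0::'a))"
    using topological_tendstoD[OF tendsto_add_Pair[of "0::'a" "0::'a"] assms(1)] assms(2) by simp
  then obtain V where V: "open V" "0 \<in> V" "\<And>x y. x \<in> V \<Longrightarrow> y \<in> V \<Longrightarrow> x + y \<in> U"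
    unfolding eventually_prod_same eventually_nhds by fastforce
  have "open (uminus -` V)"
    by (intro open_vimage V continuous_intros)
  then show thesis
    by (intro that[of "V \<inter> uminus -` V"]) (use V in auto)
qed

text \<open>
  The given complete metric need not be translation invariant, so a sequence that is Cauchy for the
  group structure is not obviously Cauchy for the metric. But it has a translate that is: the
  \<open>y\<close> for which all late terms of \<open>x - y\<close> stay \<open>\<epsilon>\<close>-close to each other, uniformly
  near \<open>y\<close>, form an open set. It is dense, because replacing \<open>y0\<close> by the nearby point
  \<open>y0 + (x M - x N)\<close> moves the late terms close to the fixed point \<open>x N - y0\<close>, and \<open>M\<close> may be
  chosen after looking at the metric there. Baire's theorem yields one \<open>y\<close> that serves every \<open>\<epsilon>\<close>.
\<close>

lemma polish_ab_group_complete: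
  fixes x :: "nat \<Rightarrow> 'a::{polish_space, topological_ab_group_add}"
  assumes cauchy: "\<And>U. open U \<Longrightarrow> 0 \<in> U \<Longrightarrow> \<exists>N. \<forall>m\<ge>N. \<forall>n\<ge>N. x m - x n \<in> U"
  shows "convergent x"
proof -
  define G where "G k = \<Union>{T. open T \<and>
      (\<exists>N. \<forall>n\<ge>N. \<forall>m\<ge>N. \<forall>y\<in>T. dist (x n - y) (x m - y) < inverse (Suc k))}" for k
  have open_G: "open (G k)" for k
    unfolding G_def by auto
  have dense_G: "closure (G k) = UNIV" for k
  proof -
    have "\<exists>y\<in>U. y \<in> G k" if U: "open U" "y0 \<in> U" for U y0
    proof -
      have "open ((\<lambda>u. y0 + u) -` U)" "0 \<in> (\<lambda>u. y0 + u) -` U"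
        using U by (auto intro!: open_vimage continuous_intros)
      then obtain N where N: "\<And>m n. m \<ge> N \<Longrightarrow> n \<ge> N \<Longrightarrow> y0 + (x m - x n) \<in> U"
        using cauchy by fastforce
      define z where "z = x N - y0"
      define r :: real where "r = inverse (Suc k) / 2"
      have "r > 0" by (simp add: r_def)
      have "open ((\<lambda>u. z + u) -` ball z r)" "0 \<in> (\<lambda>u. z + u) -` ball z r"
        using \<open>r > 0\<close> by (auto intro!: open_vimage continuous_intros)
      then obtain V where V: "open V" "0 \<in> V"
        "\<And>u v. u \<in> V \<Longrightarrow> v \<in> V \<Longrightarrow> z + (u + v) \<in> ball z r"
        by (rule symmetric_nbhd_half) auto
      obtain M where M: "M \<ge> N" "\<And>m n. m \<ge> M \<Longrightarrow> n \<ge> M \<Longrightarrow> x m - x n \<in> V"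
        using cauchy[OF V(1,2)] by (metis linorder_linear order_trans)
      define y where "y = y0 + (x M - x N)"
      define T where "T = (\<lambda>t. y - t) -` V"
      have "y \<in> T" using V by (simp add: T_def)
      moreover have "open T"
        unfolding T_def by (intro open_vimage V continuous_intros)
      moreover have close: "x n - t \<in> ball z r" if "t \<in> T" "n \<ge> M" for t n
      proof -
        have "z + ((x n - x M) + (y - t)) \<in> ball z r"
          using V(3) M(2) that by (simp add: T_def)
        then show ?thesis by (simp add: z_def y_def algebra_simps)
      qed
      have "dist (x n - t) (x m - t) < inverse (Suc k)" if "t \<in> T" "n \<ge> M" "m \<ge> M" for t m n
        using close[OF that(1,2)] close[OF that(1,3)] dist_triangle_half_r[of z "x n - t" _ "x m - t"]
        by (simp add: r_def)
      ultimately have "y \<in> G k"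
        unfolding G_def by blast
      moreover have "y \<in> U" using N M by (simp add: y_def)
      ultimately show ?thesis by blast
    qed
    then have "\<exists>y\<in>G k. dist y y0 < e" if "e > 0" for y0 e
      using that by (metis centre_in_ball dist_commute mem_ball open_ball)
    then show ?thesis
      by (auto simp: closure_approachable)
  qed
  have "euclidean closure_of \<Inter>(range G) = topspace euclidean"
    using open_G dense_G completely_metrizable_space_euclidean
    by (intro Baire_category) auto
  then have "\<Inter>(range G) \<noteq> {}"
    by (metis closure_of_empty topspace_euclidean empty_not_UNIV)
  then obtain y where y: "\<And>k. y \<in> G k"
    by auto
  have "Cauchy (\<lambda>n. x n - y)"
  proof (rule metric_CauchyI)
    fix e :: real assume "e > 0"
    then obtain k where "inverse (Suc k) < e"
      using reals_Archimedean by blast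
    moreover obtain N where "\<And>m n. m \<ge> N \<Longrightarrow> n \<ge> N \<Longrightarrow> dist (x m - y) (x n - y) < inverse (Suc k)"
      using y[of k] unfolding G_def by blast
    ultimately show "\<exists>N. \<forall>m\<ge>N. \<forall>n\<ge>N. dist (x m - y) (x n - y) < e"
      by (meson order_less_trans)
  qed
  then have "convergent (\<lambda>n. x n - y)"
    by (rule Cauchy_convergent)
  then show ?thesis
    by (simp add: convergent_diff_const_right_iff)
qed

section \<open>Scales of neighbourhoods of zero\<close>

text \<open>
  A scale takes the place of an invariant metric: \<open>x \<in> W k\<close> says that \<open>x\<close> has size at most
  \<open>2\<^sup>-\<^sup>k\<close>, or belongs to level \<open>k\<close>, and a sum of two elements costs one level. With \<open>W 0\<close> the whole group, the truncated
  subtraction in \<open>W (k - 1)\<close> is harmless, and elements of unbounded size need no separate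
  treatment. Strictness, the only trace of the group not being discrete, provides elements of every
  prescribed size.
\<close>

locale scale =
  fixes W :: "nat \<Rightarrow> 'a::{polish_space, topological_ab_group_add} set"
  assumes W_0: "W 0 = UNIV"
    and open_W: "open (W k)"
    and zero_W: "0 \<in> W k"
    and uminus_W: "x \<in> W k \<Longrightarrow> - x \<in> W k"
    and add_W: "x \<in> W (Suc k) \<Longrightarrow> y \<in> W (Suc k) \<Longrightarrow> x + y \<in> W k"
    and strict_W: "W (Suc k) \<noteq> W k"
    and base_W: "open U \<Longrightarrow> 0 \<in> U \<Longrightarrow> \<exists>k. W k \<subseteq> U"

lemma exists_scale:
  assumes "\<not> discrete (UNIV :: 'a::{polish_space, topological_ab_group_add} set)"
  obtains W :: "nat \<Rightarrow> 'a::{polish_space, topological_ab_group_add} set" where "scale W"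
proof -
  have not_open: "\<not> open {0::'a}"
  proof
    assume op: "open {0::'a}"
    have "open {a}" for a :: 'a
    proof -
      have "open ((\<lambda>x. x - a) -` {0})"
        by (intro open_vimage op continuous_intros)
      also have "(\<lambda>x. x - a) -` {0} = {a}" by auto
      finally show ?thesis .
    qed
    then show False
      using assms by (auto simp: discrete_def isolated_in_def)
  qed
  define P where "P k V \<longleftrightarrow> open V \<and> (0::'a) \<in> V \<and> (\<forall>x\<in>V. - x \<in> V) \<and>
     (if k = 0 then V = UNIV else V \<subseteq> ball 0 (1 / k))" for k :: nat and V
  have "\<exists>W. \<forall>k. P k (W k) \<and>
      ((\<forall>x\<in>W (Suc k). \<forall>y\<in>W (Suc k). x + y \<in> W k) \<and> W (Suc k) \<noteq> W k)"
  proof (rule dependent_nat_choice)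
    show "\<exists>V. P 0 V" by (simp add: P_def)
  next
    fix V k assume V: "P k V"
    \<comment> \<open>Removing a non-zero point \<open>q\<close> of \<open>V\<close> from the next neighbourhood makes the chain strict.\<close>
    then obtain q where q: "q \<in> V" "q \<noteq> 0"
      using not_open P_def[of k V] by (cases "V = {0}") auto
    have "open (V \<inter> ball 0 (1 / Suc k) - {q})" "0 \<in> V \<inter> ball 0 (1 / Suc k) - {q}"
      using V q by (auto simp: P_def intro!: open_Diff)
    then obtain V' where V': "open V'" "0 \<in> V'" "\<And>x. x \<in> V' \<Longrightarrow> - x \<in> V'"
      "\<And>x y. x \<in> V' \<Longrightarrow> y \<in> V' \<Longrightarrow> x + y \<in> V \<inter> ball 0 (1 / Suc k) - {q}"
      by (rule symmetric_nbhd_half) blast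
    have "V' \<subseteq> V \<inter> ball 0 (1 / Suc k) - {q}"
      using V'(4)[OF _ V'(2)] by auto
    then show "\<exists>V'. P (Suc k) V' \<and> (\<forall>x\<in>V'. \<forall>y\<in>V'. x + y \<in> V) \<and> V' \<noteq> V"
      using V' q by (intro exI[of _ V']) (auto simp: P_def)
  qed
  then obtain W where step: "\<And>k. P k (W k) \<and>
      ((\<forall>x\<in>W (Suc k). \<forall>y\<in>W (Suc k). x + y \<in> W k) \<and> W (Suc k) \<noteq> W k)"
    by (elim exE) blast
  then have W: "\<And>k. P k (W k)" "\<And>k x y. x \<in> W (Suc k) \<Longrightarrow> y \<in> W (Suc k) \<Longrightarrow> x + y \<in> W k"
    "\<And>k. W (Suc k) \<noteq> W k"
    by blast+
  have base: "\<exists>k. W k \<subseteq> U" if U: "open U" "0 \<in> U" for U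
  proof -
    obtain e where e: "e > 0" "ball 0 e \<subseteq> U"
      using openE[OF U] by blast
    then obtain k where "inverse (real (Suc k)) < e"
      using reals_Archimedean by blast
    then have "ball 0 (1 / Suc k) \<subseteq> ball (0::'a) e"
      by (intro subset_ball) (simp add: inverse_eq_divide)
    moreover have "W (Suc k) \<subseteq> ball 0 (1 / Suc k)"
      using W(1)[of "Suc k"] by (simp add: P_def)
    ultimately show ?thesis
      using e(2) by blast
  qed
  have "scale W"
    by unfold_locales (use W base in \<open>auto simp: P_def\<close>)
  then show thesis by (rule that)
qed

context scale
begin

lemma W_Suc_subset: "W (Suc k) \<subseteq> W k"
  using add_W[OF _ zero_W] by auto

lemma W_mono: "i \<le> j \<Longrightarrow> x \<in> W j \<Longrightarrow> x \<in> W i"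
  using lift_Suc_antimono_le[of W, OF W_Suc_subset] by blast

lemma add_W': "x \<in> W k \<Longrightarrow> y \<in> W k \<Longrightarrow> x + y \<in> W (k - 1)"
  by (cases k) (auto simp: W_0 add_W)

lemma diff_W': "x \<in> W k \<Longrightarrow> y \<in> W k \<Longrightarrow> x - y \<in> W (k - 1)"
  using add_W'[OF _ uminus_W] by fastforce

lemma eq_zero_if_in_all_W:
  assumes "\<And>k. x \<in> W k" shows "x = 0"
proof (rule ccontr)
  assume "x \<noteq> 0"
  then have "open (- {x})" "0 \<in> - {x}" by auto
  then show False using base_W assms by blast
qed

text \<open>One level pays for a passage to the limit, since the closure of a set is contained in its sum
  with any neighbourhood of zero.\<close>

lemma limit_in_W:
  assumes lim: "f \<longlonglongrightarrow> a" and f: "\<And>n. f n \<in> W k"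
  shows "a \<in> W (k - 1)"
proof -
  have "(\<lambda>n. a - f n) \<longlonglongrightarrow> a - a"
    by (intro tendsto_intros lim)
  then have "eventually (\<lambda>n. a - f n \<in> W k) sequentially"
    using topological_tendstoD[OF _ open_W zero_W] by simp
  then obtain n where "a - f n \<in> W k"
    by (auto simp: eventually_sequentially)
  then show ?thesis
    using add_W'[OF _ f[of n]] by fastforce
qed

text \<open>The counterpart of a geometric series bound: the whole tail costs no more than doubling its
  first term.\<close>

lemma sum_in_W:
  assumes y: "\<And>j. y j \<in> W (\<beta> j)" and \<beta>: "\<And>j. \<beta> j < \<beta> (Suc j)"
  shows "(\<Sum>j=m..<n. y j) \<in> W (\<beta> m - 1)"
proof (induction "n - m" arbitrary: m)
  case 0
  then show ?case using zero_W by simp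
next
  case (Suc l)
  have "(\<Sum>j=m..<n. y j) = y m + (\<Sum>j=Suc m..<n. y j)"
    using Suc(2) by (intro sum.atLeast_Suc_lessThan) simp
  moreover have "(\<Sum>j=Suc m..<n. y j) \<in> W (\<beta> m)"
    using W_mono[of "\<beta> m" "\<beta> (Suc m) - 1"] Suc(1)[of "Suc m"] Suc(2) \<beta>[of m] by simp
  ultimately show ?case
    using add_W' y by simp
qed

end

section \<open>Digit systems\<close>

definition expansions :: "(nat \<Rightarrow> 'a::{topological_space, comm_monoid_add} set) \<Rightarrow> 'a set" where
  "expansions D = {a. \<exists>x. (\<forall>j. x j \<in> D j) \<and> x sums a}"

lemma expansionsI: "(\<And>j. x j \<in> D j) \<Longrightarrow> x sums a \<Longrightarrow> a \<in> expansions D"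
  unfolding expansions_def by blast

text \<open>
  Digits at place \<open>j\<close> belong to level \<open>\<alpha> j\<close>, differences of distinct ones miss level \<open>\<sigma> j\<close>, and the
  digits at later places are so small that they cannot make up for this difference. The sets of
  digits may be infinite, so the expansions need not form a compact set. The margin of 9 levels
  leaves room between \<open>\<sigma> j\<close> and \<open>\<alpha> (j + 1)\<close> for the digits of a second system whose
  expansions differ by none of the sizes occurring here.
\<close>

locale digit_system = scale +
  fixes \<alpha> \<sigma> :: "nat \<Rightarrow> nat" and D :: "nat \<Rightarrow> 'a::{polish_space, topological_ab_group_add} set"
  assumes digit_size: "D j \<subseteq> W (\<alpha> j)"
    and digit_gap: "x \<in> D j \<Longrightarrow> y \<in> D j \<Longrightarrow> x \<noteq> y \<Longrightarrow> x - y \<notin> W (\<sigma> j)"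
    and size_less_gap: "\<alpha> j < \<sigma> j"
    and gap_less_size: "\<sigma> j + 9 \<le> \<alpha> (Suc j)"
begin

lemma size_mono: "i \<le> j \<Longrightarrow> \<alpha> i \<le> \<alpha> j"
proof (rule lift_Suc_mono_le[of \<alpha>])
  show "\<alpha> n \<le> \<alpha> (Suc n)" for n
    using size_less_gap[of n] gap_less_size[of n] by simp
qed

lemma size_gt: "j \<le> \<alpha> j"
proof (induction j)
  case (Suc j)
  then show ?case
    using size_less_gap[of j] gap_less_size[of j] by simp
qed simp

lemma gap_mono: "i \<le> j \<Longrightarrow> \<sigma> i \<le> \<sigma> j"
proof (rule lift_Suc_mono_le[of \<sigma>])
  show "\<sigma> n \<le> \<sigma> (Suc n)" for n
    using size_less_gap[of "Suc n"] gap_less_size[of n] by simp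
qed

lemma digits_summable:
  assumes x: "\<And>j. x j \<in> D j"
  obtains a where "x sums a"
proof -
  have "convergent (\<lambda>n. \<Sum>j<n. x j)"
  proof (rule polish_ab_group_complete)
    fix U :: "'a set" assume "open U" "0 \<in> U"
    then obtain k where k: "W k \<subseteq> U" using base_W by blast
    define N where "N = Suc k"
    have tail: "(\<Sum>j<n. x j) - (\<Sum>j<m. x j) \<in> W k" if "N \<le> m" "m \<le> n" for m n
    proof -
      have "(\<Sum>j<n. x j) - (\<Sum>j<m. x j) = (\<Sum>j=m..<n. x j)"
        using sum_diff_nat_ivl[of 0 m n x] that by (simp add: atLeast0LessThan)
      moreover have "(\<Sum>j=m..<n. x j) \<in> W (\<alpha> m - 1)"
      proof (rule sum_in_W)
        show "x j \<in> W (\<alpha> j)" for j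
          using digit_size x by blast
        show "\<alpha> j < \<alpha> (Suc j)" for j
          using size_less_gap[of j] gap_less_size[of j] by simp
      qed
      ultimately show ?thesis
        using W_mono[of k "\<alpha> m - 1"] size_gt[of m] that by (auto simp: N_def)
    qed
    have "(\<Sum>j<m. x j) - (\<Sum>j<n. x j) \<in> U" if "N \<le> m" "N \<le> n" for m n
      using tail[of m n] tail[of n m] that k uminus_W[of "(\<Sum>j<n. x j) - (\<Sum>j<m. x j)" k]
      by (cases "m \<le> n") auto
    then show "\<exists>N. \<forall>m\<ge>N. \<forall>n\<ge>N. (\<Sum>j<m. x j) - (\<Sum>j<n. x j) \<in> U"
      by blast
  qed
  then show thesis
    using that by (auto simp: convergent_def sums_def)
qed

text \<open>Three levels are lost: by taking differences of digits, by summing them, and by passing to the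
  limit.\<close>

lemma expansions_close:
  assumes x: "\<And>j. x j \<in> D j" "x sums a" and y: "\<And>j. y j \<in> D j" "y sums b"
    and agree: "\<And>j. j < n \<Longrightarrow> x j = y j"
  shows "a - b \<in> W (\<alpha> n - 3)"
proof -
  have "(\<Sum>j<m. x j - y j) \<in> W (\<alpha> n - 1 - 1)" for m
  proof -
    have "(\<Sum>j<m. x j - y j) = (\<Sum>j=n..<m. x j - y j)"
      using agree by (intro sum.mono_neutral_right) (auto simp: not_le)
    also have "\<dots> \<in> W (\<alpha> n - 1 - 1)"
    proof (rule sum_in_W)
      show "x j - y j \<in> W (\<alpha> j - 1)" for j
        using diff_W'[of "x j" "\<alpha> j" "y j"] digit_size x(1) y(1) by blast
      show "\<alpha> j - 1 < \<alpha> (Suc j) - 1" for j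
        using size_less_gap[of j] gap_less_size[of j] by simp
    qed
    finally show ?thesis .
  qed
  moreover have "(\<lambda>m. \<Sum>j<m. x j - y j) \<longlonglongrightarrow> a - b"
    using x(2) y(2) unfolding sums_def sum_subtractf by (intro tendsto_diff)
  ultimately have "a - b \<in> W (\<alpha> n - 1 - 1 - 1)"
    using limit_in_W by blast
  then show ?thesis by (simp add: numeral_3_eq_3)
qed

lemma expansions_apart:
  assumes x: "\<And>j. x j \<in> D j" "x sums a" and y: "\<And>j. y j \<in> D j" "y sums b"
    and agree: "\<And>j. j < n \<Longrightarrow> x j = y j" and differ: "x n \<noteq> y n"
  shows "a - b \<notin> W (\<sigma> n + 1)"
proof
  assume ab: "a - b \<in> W (\<sigma> n + 1)"
  \<comment> \<open>Correcting the first wrong digit of \<open>y\<close> brings the sum close to \<open>a\<close>, so the correction itself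
    would be small, against the gap between digits.\<close>
  define y' where "y' = y(n := x n)"
  have "(\<lambda>j. y j + (if j = n then x n - y n else 0)) sums (b + (x n - y n))"
    using y(2) sums_single[of n "\<lambda>_. x n - y n"] by (rule sums_add)
  moreover have "(\<lambda>j. y j + (if j = n then x n - y n else 0)) = y'"
    by (auto simp: y'_def)
  ultimately have y': "y' sums (b + (x n - y n))"
    by simp
  have "a - (b + (x n - y n)) \<in> W (\<alpha> (Suc n) - 3)"
    using x y(1) agree by (intro expansions_close[OF x _ y']) (auto simp: y'_def less_Suc_eq)
  then have "a - (b + (x n - y n)) \<in> W (\<sigma> n + 1)"
    using W_mono[of "\<sigma> n + 1" "\<alpha> (Suc n) - 3"] gap_less_size[of n] by simp
  then have "(a - b) - (a - (b + (x n - y n))) \<in> W (\<sigma> n + 1 - 1)"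
    by (rule diff_W'[OF ab])
  then have "x n - y n \<in> W (\<sigma> n)" by (simp add: algebra_simps)
  with digit_gap x(1) y(1) differ show False by blast
qed

text \<open>The first place \<open>n\<close> where the digits differ determines the size. So the sizes between
  \<open>\<sigma> n + 1\<close> and \<open>\<alpha> (n + 1) - 3\<close> never occur.\<close>

lemma expansion_differences:
  assumes "a \<in> expansions D" "b \<in> expansions D" "a \<noteq> b"
  obtains n where "a - b \<in> W (\<alpha> n - 3)" "a - b \<notin> W (\<sigma> n + 1)"
proof -
  from assms obtain x y where x: "\<And>j. x j \<in> D j" "x sums a" and y: "\<And>j. y j \<in> D j" "y sums b"
    unfolding expansions_def by blast
  define n where "n = (LEAST n. x n \<noteq> y n)"
  have "x \<noteq> y" using x(2) y(2) assms(3) sums_unique2 by blast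
  then have "\<exists>n. x n \<noteq> y n" by auto
  then have "x n \<noteq> y n" unfolding n_def by (rule LeastI_ex)
  moreover have "x j = y j" if "j < n" for j
    using not_less_Least that unfolding n_def by blast
  ultimately show thesis
    using expansions_close[OF x y] expansions_apart[OF x y] that by blast
qed

lemma digits_eq:
  assumes x: "\<And>j. x j \<in> D j" "x sums a" and y: "\<And>j. y j \<in> D j" "y sums b"
    and ab: "a - b \<in> W (\<sigma> n + 1)" and "j \<le> n"
  shows "x j = y j"
  using \<open>j \<le> n\<close>
proof (induction j rule: less_induct)
  case (less j)
  have "a - b \<in> W (\<sigma> j + 1)"
    using W_mono[OF _ ab] gap_mono[OF less(2)] by simp
  then show ?case
    using expansions_apart[OF x y, of j] less by fastforce
qed

lemma digits_unique:
  assumes x: "\<And>j. x j \<in> D j" "x sums a" and y: "\<And>j. y j \<in> D j" "y sums a"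
  shows "x = y"
  using digits_eq[OF x y, of j j for j] zero_W by auto

text \<open>Close expansions share their first digits, so the digits of expansions tending to \<open>a\<close> stabilise
  at every place; the digits in the limit are digits of \<open>a\<close>.\<close>

lemma closed_expansions: "closed (expansions D)"
proof -
  have "a \<in> expansions D" if a: "a \<in> closure (expansions D)" for a
  proof -
    have "\<exists>e x. e - a \<in> W (\<sigma> n + 2) \<and> (\<forall>j. x j \<in> D j) \<and> x sums e" for n
    proof -
      have "open ((\<lambda>e. e - a) -` W (\<sigma> n + 2))" "a \<in> (\<lambda>e. e - a) -` W (\<sigma> n + 2)"
        using zero_W by (auto intro!: open_vimage open_W continuous_intros)
      then show ?thesis
        using a unfolding closure_iff_nhds_not_empty expansions_def by blast
    qed
    then obtain e x where e: "\<And>n. e n - a \<in> W (\<sigma> n + 2)"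
      and x: "\<And>n j. x n j \<in> D j" "\<And>n. x n sums e n"
      by metis
    have stable: "x m j = x n j" if "j \<le> n" "n \<le> m" for j n m
    proof (rule digits_eq)
      have "e m - a \<in> W (\<sigma> n + 2)"
        using e[of m] gap_mono[OF \<open>n \<le> m\<close>] by (auto elim: W_mono[rotated])
      then have "(e m - a) - (e n - a) \<in> W (\<sigma> n + 2 - 1)"
        using e by (rule diff_W')
      then show "e m - e n \<in> W (\<sigma> n + 1)" by simp
    qed (use x that in auto)
    define y where "y j = x j j" for j
    have y: "\<And>j. y j \<in> D j" by (simp add: y_def x)
    then obtain b where b: "y sums b" by (rule digits_summable)
    have "b - a \<in> W k" for k
    proof -
      have "b - e k \<in> W (\<alpha> (Suc k) - 3)"
        using stable[OF order_refl, of _ k] by (intro expansions_close[OF y b x]) (auto simp: y_def)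
      then have "b - e k \<in> W (\<sigma> k + 2)"
        using W_mono[of "\<sigma> k + 2" "\<alpha> (Suc k) - 3"] gap_less_size[of k] by simp
      then have "(b - e k) + (e k - a) \<in> W (\<sigma> k + 2 - 1)"
        using e by (rule add_W')
      then have "b - a \<in> W (\<sigma> k + 1)" by simp
      then show ?thesis
        using W_mono[of k "\<sigma> k + 1"] size_gt[of k] size_less_gap[of k] by simp
    qed
    then have "b - a = 0" by (rule eq_zero_if_in_all_W)
    then show ?thesis
      using y b unfolding expansions_def by auto
  qed
  then show ?thesis
    by (metis closure_subset_eq subsetI)
qed

end

section \<open>Packing a set of expansions\<close>

lemma continuum_le_card_of:
  fixes s :: "nat set \<Rightarrow> 'b"
  assumes "inj s" "range s \<subseteq> X"
  shows "|UNIV :: real set| \<le>o |X|"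
proof -
  have "|UNIV :: nat set set| \<le>o |X|"
    using assms card_of_ordLeq by blast
  moreover have "|UNIV :: real set| =o |UNIV :: nat set set|"
    using nat_sets_eqpoll_reals eqpoll_sym eqpoll_iff_card_of_ordIso by blast
  ultimately show ?thesis
    using ordIso_ordLeq_trans by blast
qed

context digit_system
begin

lemma inj_expansion_value:
  assumes "\<And>z j. F z j \<in> D j" "\<And>z. F z sums s z" "inj F"
  shows "inj s"
proof (rule injI)
  fix z z' assume "s z = s z'"
  then have "F z = F z'"
    using assms(1,2) digits_unique[of "F z" "s z" "F z'"] by metis
  then show "z = z'"
    using assms(3) by (simp add: inj_eq)
qed

text \<open>
  The translates by \<open>x\<close> and \<open>y\<close> are disjoint as soon as \<open>y - x\<close> is no difference of expansions, and
  by the preceding description of such differences their sizes leave gaps. The translating elements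
  are the expansions in a second digit system with the two digits 0 and \<open>p\<close> at each place, where
  \<open>p\<close> is taken with its size in the gap; their differences have sizes in the gaps only.
\<close>

lemma continuum_packing_expansions:
  obtains S where "disjoint_family_on (\<lambda>x. (+) x ` expansions D) S" "|UNIV :: real set| \<le>o |S|"
proof -
  have "\<exists>p. p \<in> W k \<and> p \<notin> W (Suc k)" for k
    using strict_W W_Suc_subset by blast
  then obtain p where p: "\<And>k. p k \<in> W k" "\<And>k. p k \<notin> W (Suc k)"
    by metis
  \<comment> \<open>Level \<open>\<sigma> j + 4\<close> is central in the gap between \<open>\<sigma> j + 1\<close> and \<open>\<alpha> (j + 1) - 3\<close>, far enough from
    both ends for the differences of expansions over \<open>T\<close> to stay inside.\<close>
  define T where "T j = {0, p (\<sigma> j + 4)}" for j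
  interpret T: digit_system W "\<lambda>j. \<sigma> j + 4" "\<lambda>j. \<sigma> j + 5" T
  proof
    show "T j \<subseteq> W (\<sigma> j + 4)" for j
      using p zero_W by (auto simp: T_def)
    show "x - y \<notin> W (\<sigma> j + 5)" if "x \<in> T j" "y \<in> T j" "x \<noteq> y" for x y j
      using that p(2)[of "\<sigma> j + 4"] uminus_W[of "- p (\<sigma> j + 4)" "\<sigma> j + 5"]
      by (auto simp: T_def eval_nat_numeral)
    show "\<sigma> j + 5 + 9 \<le> \<sigma> (Suc j) + 4" for j
      using gap_less_size[of j] size_less_gap[of "Suc j"] by simp
  qed simp
  define F where "F Z j = (if j \<in> Z then p (\<sigma> j + 4) else 0)" for Z j
  have F: "F Z j \<in> T j" for Z j by (simp add: F_def T_def)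
  then have "\<exists>a. F Z sums a" for Z using T.digits_summable by metis
  then obtain s where s: "\<And>Z. F Z sums s Z" by metis
  have nz: "p k \<noteq> 0" for k using p(2)[of k] zero_W by metis
  have "inj F"
    by (rule injI, rule set_eqI) (metis F_def nz)
  then have "inj s" by (rule T.inj_expansion_value[OF F s])
  moreover have "range s \<subseteq> expansions T"
    using F s by (auto simp: expansions_def)
  ultimately have "|UNIV :: real set| \<le>o |expansions T|"
    by (rule continuum_le_card_of)
  moreover have "disjoint_family_on (\<lambda>x. (+) x ` expansions D) (expansions T)"
    unfolding disjoint_family_on_def
  proof (intro ballI impI, rule ccontr)
    fix x y assume xy: "x \<in> expansions T" "y \<in> expansions T" "x \<noteq> y"
      and "(+) x ` expansions D \<inter> (+) y ` expansions D \<noteq> {}"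
    then obtain a b where ab: "a \<in> expansions D" "b \<in> expansions D" "x + a = y + b"
      by auto
    then have eq: "a - b = y - x" by (simp add: algebra_simps)
    then have "a \<noteq> b" using xy by auto
    then obtain n where n: "a - b \<in> W (\<alpha> n - 3)" "a - b \<notin> W (\<sigma> n + 1)"
      by (rule expansion_differences[OF ab(1,2)])
    obtain m where m: "y - x \<in> W (\<sigma> m + 4 - 3)" "y - x \<notin> W (\<sigma> m + 5 + 1)"
      by (rule T.expansion_differences[OF xy(2,1)]) (use xy in auto)
    show False
    proof (cases "n \<le> m")
      case True
      then show False
        using gap_mono[of n m] W_mono[OF _ m(1), of "\<sigma> n + 1"] n(2) eq by simp
    next
      case False
      then show False
        using size_mono[of "Suc m" n] gap_less_size[of m]
          W_mono[OF _ n(1), of "\<sigma> m + 5 + 1"] m(2) eq by simp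
    qed
  qed
  ultimately show thesis using that by blast
qed

end

section \<open>Redundant digits\<close>

context scale
begin

lemma exists_separated_net:
  obtains N where "N \<subseteq> X" "\<And>x y. x \<in> N \<Longrightarrow> y \<in> N \<Longrightarrow> x \<noteq> y \<Longrightarrow> x - y \<notin> W k"
    "\<And>r. r \<in> X \<Longrightarrow> \<exists>x\<in>N. r - x \<in> W k"
proof -
  define P where "P = {N. N \<subseteq> X \<and> (\<forall>x\<in>N. \<forall>y\<in>N. x \<noteq> y \<longrightarrow> x - y \<notin> W k)}"
  have "\<Union>C \<in> P" if "C \<in> chains P" for C
  proof -
    have "x - y \<notin> W k" if "x \<in> K" "K \<in> C" "y \<in> L" "L \<in> C" "x \<noteq> y" for x y K L
    proof -
      have "K \<in> P" "L \<in> P" "K \<subseteq> L \<or> L \<subseteq> K"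
        using \<open>C \<in> chains P\<close> that by (auto simp: chains_def chain_subset_def)
      then show ?thesis using that unfolding P_def by blast
    qed
    then show ?thesis
      using that by (auto simp: P_def chains_def)
  qed
  then obtain N where N: "N \<in> P" "\<And>K. K \<in> P \<Longrightarrow> N \<subseteq> K \<Longrightarrow> K = N"
    using Zorn_Lemma2[of P] by (metis Union_upper)
  show thesis
  proof
    show "\<exists>x\<in>N. r - x \<in> W k" if "r \<in> X" for r
    proof (rule ccontr)
      assume far: "\<not> ?thesis"
      then have "x - r \<notin> W k" if "x \<in> N" for x
        using uminus_W[of "x - r" k] that by auto
      then have "insert r N \<in> P"
        using N(1) far that by (auto simp: P_def)
      then have "r \<in> N" using N(2) by blast
      then show False using far zero_W by auto
    qed
  qed (use N(1) in \<open>auto simp: P_def\<close>)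
qed

text \<open>
  Let \<open>p\<close> belong to \<open>W k\<close> but not to \<open>W (k + 1)\<close>. In a net much finer than \<open>p\<close>, the points next to \<open>r\<close> and to
  \<open>r - p\<close> are distinct, while both are within about the size of \<open>p\<close> of \<open>r\<close>. So a separated set of
  digits can still offer two choices at each step of an expansion.
\<close>

lemma exists_redundant_digits:
  assumes "m \<le> k"
  obtains N where "N \<subseteq> W (m - 1)"
    "\<And>x y. x \<in> N \<Longrightarrow> y \<in> N \<Longrightarrow> x \<noteq> y \<Longrightarrow> x - y \<notin> W (k + 2)"
    "\<And>r. r \<in> W m \<Longrightarrow> \<exists>x\<in>N. \<exists>y\<in>N. x \<noteq> y \<and> r - x \<in> W (k - 1) \<and> r - y \<in> W (k - 1)"
proof -
  obtain N where N: "N \<subseteq> W (m - 1)"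
    "\<And>x y. x \<in> N \<Longrightarrow> y \<in> N \<Longrightarrow> x \<noteq> y \<Longrightarrow> x - y \<notin> W (k + 2)"
    "\<And>r. r \<in> W (m - 1) \<Longrightarrow> \<exists>x\<in>N. r - x \<in> W (k + 2)"
    by (rule exists_separated_net[of "W (m - 1)" "k + 2"]) blast
  obtain p where p: "p \<in> W k" "p \<notin> W (Suc k)"
    using strict_W W_Suc_subset by blast
  have "\<exists>x\<in>N. \<exists>y\<in>N. x \<noteq> y \<and> r - x \<in> W (k - 1) \<and> r - y \<in> W (k - 1)" if r: "r \<in> W m" for r
  proof -
    have "r \<in> W (m - 1)" "r - p \<in> W (m - 1)"
      using W_mono[of "m - 1" m] diff_W'[OF r] r p W_mono[OF assms] by auto
    then obtain x y where x: "x \<in> N" "r - x \<in> W (k + 2)" and y: "y \<in> N" "r - p - y \<in> W (k + 2)"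
      using N(3) by metis
    have "x \<noteq> y"
    proof
      assume "x = y"
      have "(r - x) - (r - p - y) \<in> W (k + 2 - 1)"
        using x(2) y(2) by (rule diff_W')
      then show False using p(2) \<open>x = y\<close> by simp
    qed
    moreover have "r - x \<in> W (k - 1)"
      using W_mono[OF _ x(2)] by simp
    moreover have "p + (r - p - y) \<in> W (k - 1)"
      using p(1) W_mono[OF _ y(2), of k] by (intro add_W') auto
    then have "r - y \<in> W (k - 1)" by (simp add: algebra_simps)
    ultimately show ?thesis using x(1) y(1) by blast
  qed
  with N(1,2) show thesis
    by - (rule that)
qed

text \<open>
  At place \<open>n\<close> a remainder in \<open>W (16 * n - 13)\<close> is replaced by a remainder in \<open>W (16 * n + 3)\<close>, which is
  what place \<open>n + 1\<close> starts from. The digits at all places together do not form a digit system: at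
  two consecutive places the gap between digits is finer than the size of the next ones. Every
  second place does form one, as 12 levels then separate the two. This is why the
  expansions are divided into even and odd places. The digits at odd places are negated so that
  \<open>g = a - b\<close>, that is \<open>a = g + b\<close>.
\<close>

lemma exists_packing_pair:
  obtains A B :: "'a set" where "closed A" "closed B"
    "\<And>g. |UNIV :: real set| \<le>o |A \<inter> (+) g ` B|"
    "\<exists>S. disjoint_family_on (\<lambda>x. (+) x ` A) S \<and> |UNIV :: real set| \<le>o |S|"
    "\<exists>S. disjoint_family_on (\<lambda>x. (+) x ` B) S \<and> |UNIV :: real set| \<le>o |S|"
proof -
  have "\<exists>N. N \<subseteq> W (16 * n - 14) \<and>
      (\<forall>x\<in>N. \<forall>y\<in>N. x \<noteq> y \<longrightarrow> x - y \<notin> W (16 * n + 6)) \<and>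
      (\<forall>r\<in>W (16 * n - 13). \<exists>x\<in>N. \<exists>y\<in>N. x \<noteq> y \<and> r - x \<in> W (16 * n + 3) \<and> r - y \<in> W (16 * n + 3))" for n
  proof -
    have le: "16 * n - 13 \<le> 16 * n + 4" by simp
    obtain N where "N \<subseteq> W (16 * n - 13 - 1)"
      "\<And>x y. x \<in> N \<Longrightarrow> y \<in> N \<Longrightarrow> x \<noteq> y \<Longrightarrow> x - y \<notin> W (16 * n + 4 + 2)"
      "\<And>r. r \<in> W (16 * n - 13) \<Longrightarrow> \<exists>x\<in>N. \<exists>y\<in>N. x \<noteq> y \<and>
        r - x \<in> W (16 * n + 4 - 1) \<and> r - y \<in> W (16 * n + 4 - 1)"
      by (rule exists_redundant_digits[OF le]) blast
    then show ?thesis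
      by (intro exI[of _ N]) (simp add: add.commute)
  qed
  then obtain N where N_size: "\<And>n. N n \<subseteq> W (16 * n - 14)"
    and N_gap: "\<And>n x y. x \<in> N n \<Longrightarrow> y \<in> N n \<Longrightarrow> x \<noteq> y \<Longrightarrow> x - y \<notin> W (16 * n + 6)"
    and N_two: "\<And>n r. r \<in> W (16 * n - 13) \<Longrightarrow>
      \<exists>x\<in>N n. \<exists>y\<in>N n. x \<noteq> y \<and> r - x \<in> W (16 * n + 3) \<and> r - y \<in> W (16 * n + 3)"
    by metis
  define f where "f n r = (SOME h :: bool \<Rightarrow> 'a. h True \<noteq> h False \<and>
      (\<forall>b. h b \<in> N n \<and> r - h b \<in> W (16 * n + 3)))" for n r
  have f: "f n r True \<noteq> f n r False \<and> (\<forall>b. f n r b \<in> N n \<and> r - f n r b \<in> W (16 * n + 3))"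
    if r: "r \<in> W (16 * n - 13)" for n r
  proof -
    obtain x y where xy: "x \<in> N n" "y \<in> N n" "x \<noteq> y"
      "r - x \<in> W (16 * n + 3)" "r - y \<in> W (16 * n + 3)"
      using N_two[OF r] by blast
    show ?thesis
      unfolding f_def by (rule someI[of _ "\<lambda>b. if b then x else y"]) (use xy in auto)
  qed
  define D E where "D j = N (2 * j)" and "E j = uminus ` N (2 * j + 1)" for j
  interpret A: digit_system W "\<lambda>j. 16 * (2 * j) - 14" "\<lambda>j. 16 * (2 * j) + 6" D
  proof
    show "D j \<subseteq> W (16 * (2 * j) - 14)" for j
      unfolding D_def by (rule N_size)
    show "x - y \<notin> W (16 * (2 * j) + 6)" if "x \<in> D j" "y \<in> D j" "x \<noteq> y" for x y j
      using that unfolding D_def by (rule N_gap)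
  qed auto
  interpret B: digit_system W "\<lambda>j. 16 * (2 * j + 1) - 14" "\<lambda>j. 16 * (2 * j + 1) + 6" E
  proof
    show "E j \<subseteq> W (16 * (2 * j + 1) - 14)" for j
      using N_size[of "2 * j + 1"] uminus_W unfolding E_def by blast
    show "x - y \<notin> W (16 * (2 * j + 1) + 6)" if xy: "x \<in> E j" "y \<in> E j" "x \<noteq> y" for x y j
    proof -
      obtain u v where uv: "x = - u" "y = - v" "u \<in> N (2 * j + 1)" "v \<in> N (2 * j + 1)"
        using xy unfolding E_def by blast
      then have "v - u \<notin> W (16 * (2 * j + 1) + 6)"
        using xy by (intro N_gap) auto
      then show ?thesis by (simp add: uv)
    qed
  qed auto
  have "|UNIV :: real set| \<le>o |expansions D \<inter> (+) g ` expansions E|" for g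
  proof -
    \<comment> \<open>The set \<open>Z\<close> decides between the two digits offered at each even place; at odd places the
      same one of the two is always taken, so that the digits at even places determine the rest.\<close>
    define bit where "bit Z n \<longleftrightarrow> even n \<and> n div 2 \<in> Z" for Z and n :: nat
    define r where "r Z n = rec_nat g (\<lambda>n r. r - f n r (bit Z n)) n" for Z n
    define x where "x Z n = f n (r Z n) (bit Z n)" for Z n
    have r_simps: "r Z 0 = g" "r Z (Suc n) = r Z n - x Z n" for Z n
      by (simp_all add: r_def x_def)
    have r_W: "r Z n \<in> W (16 * n - 13)" for Z n
    proof (induction n)
      case (Suc n)
      then show ?case using f[OF Suc] by (simp add: r_simps x_def add.commute)
    qed (simp add: W_0)
    have x_N: "x Z n \<in> N n" for Z n
      using f[OF r_W] by (simp add: x_def)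
    have x_even: "x Z (2 * j) \<in> D j" for Z j
      using x_N by (simp add: D_def)
    have x_odd: "- x Z (2 * j + 1) \<in> E j" for Z j
      using x_N by (simp add: E_def)
    have "\<exists>a. (\<lambda>j. x Z (2 * j)) sums a" for Z
      using A.digits_summable[of "\<lambda>j. x Z (2 * j)"] x_even by metis
    then obtain a where a: "\<And>Z. (\<lambda>j. x Z (2 * j)) sums a Z" by metis
    have "\<exists>b. (\<lambda>j. - x Z (2 * j + 1)) sums b" for Z
      using B.digits_summable[of "\<lambda>j. - x Z (2 * j + 1)"] x_odd by metis
    then obtain b where b: "\<And>Z. (\<lambda>j. - x Z (2 * j + 1)) sums b Z" by metis
    have g: "g + b Z = a Z" for Z
    proof -
      have r_eq: "r Z (2 * m) = g - ((\<Sum>j<m. x Z (2 * j)) - (\<Sum>j<m. - x Z (2 * j + 1)))" for m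
        by (induction m) (simp_all add: r_simps algebra_simps)
      have lim: "(\<lambda>m. r Z (2 * m)) \<longlonglongrightarrow> g - (a Z - b Z)"
        unfolding r_eq using a b unfolding sums_def by (intro tendsto_intros) 
      have "g - (a Z - b Z) \<in> W k" for k
      proof -
        have "r Z (2 * (m + Suc k)) \<in> W (Suc k)" for m
          using W_mono[OF _ r_W, of "Suc k" "2 * (m + Suc k)"] by simp
        then have "g - (a Z - b Z) \<in> W (Suc k - 1)"
          by (rule limit_in_W[OF LIMSEQ_ignore_initial_segment[OF lim, of "Suc k"]])
        then show ?thesis by simp
      qed
      then have "g - (a Z - b Z) = 0" by (rule eq_zero_if_in_all_W)
      then show ?thesis by (simp add: algebra_simps)
    qed
    \<comment> \<open>Equal digits at the even places force equal remainders throughout, hence equal choices.\<close>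
    have "inj (\<lambda>Z j. x Z (2 * j))"
    proof (rule injI)
      fix Z Z' assume "(\<lambda>j. x Z (2 * j)) = (\<lambda>j. x Z' (2 * j))"
      then have eq: "x Z (2 * j) = x Z' (2 * j)" for j by metis
      have r_eq: "r Z n = r Z' n" for n
      proof (induction n)
        case (Suc n)
        have "x Z n = x Z' n"
        proof (cases "even n")
          case True
          then show ?thesis using eq by (auto elim!: evenE)
        next
          case False
          then show ?thesis using Suc by (simp add: x_def bit_def)
        qed
        then show ?case using Suc by (simp add: r_simps)
      qed (simp add: r_simps)
      have "j \<in> Z \<longleftrightarrow> j \<in> Z'" for j
        using eq[of j] f[OF r_W, of "2 * j" Z'] r_eq[of "2 * j"]
        by (cases "j \<in> Z"; cases "j \<in> Z'") (auto simp: x_def bit_def)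
      then show "Z = Z'" by blast
    qed
    then have "inj a"
      by (rule A.inj_expansion_value[OF x_even a])
    moreover have "range a \<subseteq> expansions D \<inter> (+) g ` expansions E"
    proof safe
      fix Z
      show "a Z \<in> expansions D"
        using x_even a by (rule expansionsI)
      have "b Z \<in> expansions E"
        using x_odd b by (rule expansionsI)
      then show "a Z \<in> (+) g ` expansions E"
        using g by (metis imageI)
    qed
    ultimately show ?thesis by (rule continuum_le_card_of)
  qed
  moreover have "\<exists>S. disjoint_family_on (\<lambda>x. (+) x ` expansions D) S \<and> |UNIV :: real set| \<le>o |S|"
    using A.continuum_packing_expansions by metis
  moreover have "\<exists>S. disjoint_family_on (\<lambda>x. (+) x ` expansions E) S \<and> |UNIV :: real set| \<le>o |S|"
    using B.continuum_packing_expansions by metis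
  ultimately show thesis
    by (rule that[OF A.closed_expansions B.closed_expansions])
qed

end

section \<open>Cardinalities and indices\<close>

lemma card_of_polish_le_continuum:
  "|UNIV :: 'a::{second_countable_topology, t1_space} set| \<le>o |UNIV :: real set|"
proof -
  obtain \<B> :: "'a set set" where \<B>: "countable \<B>" "topological_basis \<B>"
    using ex_countable_basis by blast
  \<comment> \<open>A point is determined by the set of (numbers of) basic open sets that contain it.\<close>
  define c where "c x = to_nat_on \<B> ` {U \<in> \<B>. x \<in> U}" for x
  have "inj c"
  proof (rule injI, rule ccontr)
    fix x y assume c: "c x = c y" and "x \<noteq> y"
    then obtain U where U: "open U" "x \<in> U" "y \<notin> U" by (meson t1_space)
    then obtain V where V: "V \<in> \<B>" "x \<in> V" "V \<subseteq> U"
      using \<B>(2) topological_basisE by metis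
    then have "to_nat_on \<B> V \<in> c y" using c by (auto simp: c_def)
    then show False
      using V U \<B>(1) by (auto simp: c_def inj_on_eq_iff[OF inj_on_to_nat_on])
  qed
  then have "|UNIV :: 'a set| \<le>o |UNIV :: nat set set|"
    using card_of_ordLeq[of "UNIV :: 'a set" "UNIV :: nat set set"] by auto
  moreover have "|UNIV :: nat set set| =o |UNIV :: real set|"
    using nat_sets_eqpoll_reals eqpoll_iff_card_of_ordIso by blast
  ultimately show ?thesis by (rule ordLeq_ordIso_trans)
qed

lemma packing_index_eq:
  fixes A :: "'a::group_add set"
  assumes "disjoint_family_on (\<lambda>x. (+) x ` A) S" "|UNIV :: 'a set| \<le>o |S|"
  shows "packing_index A =o |UNIV :: 'a set|"
  unfolding packing_index_def
proof (rule ordIso_iff_ordLeq[THEN iffD2, OF conjI])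
  let ?K = "{ |S| | S. disjoint_family_on (\<lambda>x. (+) x ` A) S}"
  have K: "?K \<subseteq> range card_of" by blast
  show "card_sup ?K \<le>o |UNIV :: 'a set|"
    by (rule card_sup_least[OF K card_of_Card_order]) (auto intro: card_of_mono1)
  have "|S| \<le>o card_sup ?K"
    using assms(1) by (intro card_sup_upper[OF K]) blast
  with assms(2) show "|UNIV :: 'a set| \<le>o card_sup ?K"
    by (rule ordLeq_transitive)
qed

lemma almost_packing_index_eq_one:
  fixes A :: "'a::group_add set"
  assumes "\<And>x y. |A| \<le>o |(+) x ` A \<inter> (+) y ` A|"
  shows "almost_packing_index A =o BNF_Cardinal_Arithmetic.cone"
  unfolding almost_packing_index_def
proof (rule ordIso_iff_ordLeq[THEN iffD2, OF conjI])
  let ?K = "{ |S| | S. almost_disjoint_translates A S}"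
  have K: "?K \<subseteq> range card_of" by blast
  have "|S| \<le>o BNF_Cardinal_Arithmetic.cone" if "almost_disjoint_translates A S" for S
  proof -
    have "x = y" if "x \<in> S" "y \<in> S" for x y
      using that \<open>almost_disjoint_translates A S\<close> assms[of x y] not_ordLess_ordLeq
      unfolding almost_disjoint_translates_def by blast
    then have "inj_on (\<lambda>_. ()) S" by (auto intro: inj_onI)
    then show ?thesis
      unfolding BNF_Cardinal_Arithmetic.cone_def card_of_ordLeq[symmetric] by (intro exI[of _ "\<lambda>_. ()"]) auto
  qed
  then show "card_sup ?K \<le>o BNF_Cardinal_Arithmetic.cone"
    by (intro card_sup_least[OF K]) (auto simp: BNF_Cardinal_Arithmetic.cone_def card_of_Card_order)
  have "BNF_Cardinal_Arithmetic.cone \<le>o |{0 :: 'a}|"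
    unfolding BNF_Cardinal_Arithmetic.cone_def card_of_ordLeq[symmetric] by (intro exI[of _ "\<lambda>_. 0"]) auto
  moreover have "|{0 :: 'a}| \<le>o card_sup ?K"
    by (rule card_sup_upper[OF K]) (auto simp: almost_disjoint_translates_def)
  ultimately show "BNF_Cardinal_Arithmetic.cone \<le>o card_sup ?K"
    by (rule ordLeq_transitive)
qed

theorem theorem3:
  assumes "\<not> discrete (UNIV :: 'a::{polish_space, topological_ab_group_add} set)"
  shows "\<exists>A B :: 'a set. closed A \<and> closed B \<and> A \<noteq> {} \<and> B \<noteq> {} \<and>
           packing_index A =o |UNIV :: real set| \<and>
           packing_index B =o |UNIV :: real set| \<and>
           almost_packing_index (A \<union> B) =o BNF_Cardinal_Arithmetic.cone"
proof -
  obtain W :: "nat \<Rightarrow> 'a set" where "scale W"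
    using assms by (rule exists_scale)
  then interpret scale W .
  obtain A B :: "'a set" where closed: "closed A" "closed B"
    and large: "\<And>g. |UNIV :: real set| \<le>o |A \<inter> (+) g ` B|"
    and packA: "\<exists>S. disjoint_family_on (\<lambda>x. (+) x ` A) S \<and> |UNIV :: real set| \<le>o |S|"
    and packB: "\<exists>S. disjoint_family_on (\<lambda>x. (+) x ` B) S \<and> |UNIV :: real set| \<le>o |S|"
    by (rule exists_packing_pair) blast
  have G_le: "|UNIV :: 'a set| \<le>o |UNIV :: real set|"
    by (rule card_of_polish_le_continuum)
  have "|UNIV :: real set| \<le>o |UNIV :: 'a set|"
    using large[of 0] card_of_mono1[OF subset_UNIV] by (rule ordLeq_transitive)
  with G_le have G: "|UNIV :: 'a set| =o |UNIV :: real set|"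
    by (simp add: ordIso_iff_ordLeq)
  have index: "packing_index X =o |UNIV :: real set|"
    if "\<exists>S. disjoint_family_on (\<lambda>x. (+) x ` X) S \<and> |UNIV :: real set| \<le>o |S|" for X :: "'a set"
    using that packing_index_eq G G_le ordLeq_transitive ordIso_transitive by blast
  have "almost_packing_index (A \<union> B) =o BNF_Cardinal_Arithmetic.cone"
  proof (rule almost_packing_index_eq_one)
    fix x y :: 'a
    have "|A \<union> B| \<le>o |UNIV :: real set|"
      using card_of_mono1[OF subset_UNIV] G_le by (rule ordLeq_transitive)
    also have "|UNIV :: real set| \<le>o |A \<inter> (+) (y - x) ` B|"
      by (rule large)
    also have "|A \<inter> (+) (y - x) ` B| \<le>o |(+) x ` (A \<union> B) \<inter> (+) y ` (A \<union> B)|"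
      unfolding card_of_ordLeq[symmetric]
    proof (intro exI[of _ "(+) x"] conjI)
      show "(+) x ` (A \<inter> (+) (y - x) ` B) \<subseteq> (+) x ` (A \<union> B) \<inter> (+) y ` (A \<union> B)"
        by (auto simp: algebra_simps)
    qed (auto intro: inj_onI)
    finally show "|A \<union> B| \<le>o |(+) x ` (A \<union> B) \<inter> (+) y ` (A \<union> B)|" .
  qed
  moreover have "A \<noteq> {}" "B \<noteq> {}"
    using large[of 0] card_of_empty3[of "UNIV :: real set"] by auto
  ultimately show ?thesis
    using closed index[OF packA] index[OF packB] by blast
qed

end
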